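(* Consider the system $x(t+1)=f(x(t),u(t),\theta)$ with $f$ of class $C^1$ in all arguments, true parameter $\theta\in\Omega_\theta$, where $\Omega_\theta\subset\mathbb{R}^{n_\theta}$ is compact and convex, and target state $x_*\in\mathbb{R}^n$. Assume: (i) (algebraic reachability) for every $x\in\mathbb{R}^n$ and every $\xi\in\Omega_\theta$ there exist $N>0$ and an input sequence $u[0,N-1]$ such that $\varphi(N,0,x;u,\xi)=x_*$; (ii) (excitation) there exist $N$ and an input sequence $u[0,N-1]$ such that for every $x\in\mathbb{R}^n$ and every $\xi\in\Omega_\theta$, the trajectory $X[0,N;u,\xi]$ started at $x(0)=x$ satisfies $\operatorname{rank}\frac{\partial X[0,N;u,\xi]}{\partial \xi}=n_\theta$. Then, for any initial state $x(0)$, and provided that exact solutions of the nonlinear equations appearing in the algorithm are available, the adaptive set-point regulation algorithm described in the context terminates after finitely many iterations (whichever exact solutions are selected), and the state of the system reaches the target state $x_*$.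
   Context: Notation. The system is $x(t+1)=f(x(t),u(t),\theta)$, $t\in\mathbb{N}=\{0,1,2,\dots\}$, with state $x(t)\in\mathbb{R}^n$, input $u(t)\in\mathbb{R}^{n_u}$ and parameter in $\mathbb{R}^{n_\theta}$; $\theta\in\Omega_\theta$ denotes the true (unknown, to be estimated) parameter that generates the actual state trajectory. $u[t_0,t_1]$ denotes the sequence $(u(t_0),\dots,u(t_1))$. For a parameter value $\xi$, $\varphi(t_1,t_0,x;u,\xi)$ denotes the solution at time $t_1$ of $z(t+1)=f(z(t),u(t),\xi)$ with $z(t_0)=x$, and $X[t_0,t_1;u,\xi]$ denotes the corresponding sequence of states from time $t_0$ to time $t_1$, identified with a vector in $\mathbb{R}^{n(t_1-t_0+1)}$. Given times $0=T_0<T_1<T_2<\cdots$, the initial state $x(0)$ and the inputs applied so far, define for a parameter value $\xi$ $$g_k(\xi)=\big(\varphi(1,0,x(0);u,\xi)^T,\dots,\varphi(T_k,0,x(0);u,\xi)^T\big)^T ,\qquad h_k(\xi)=\varphi(T_k+N_k,0,x(0);u,\xi).$$ Thus $g_k(\theta)$ is the vector of actual states $x(1),\dots,x(T_k)$. Algorithm. Initialization: given $x(0)$, let $u[0,N_0-1]$ be an excitation signal, i.e. a sequence as in hypothesis (ii) with $N=N_0$; set $T_0=0$, $T_1=N_0$, $k=1$; apply $u[0,N_0-1]$ to the actual system (parameter $\theta$) to obtain $x(T_1)$. Loop: If $x(T_k)=x_*$, break (terminate). Otherwise: - obtain $\theta_k\in\Omega_\theta$ satisfying $g_k(\theta_k)=g_k(\theta)$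 (any such $\theta_k$; it need not equal $\theta$); - obtain $N_k>0$ and $u[T_k,T_k+N_k-1]$ satisfying $h_k(\theta_k)=x_*$ (any such choice); - let $T_{k+1}=T_k+N_k$; - apply $u[T_k,T_{k+1}-1]$ to the actual system (parameter $\theta$) to obtain $x(T_{k+1})$; - replace $k$ by $k+1$ and repeat the loop. *)

theory Defs
  imports "HOL-Analysis.Analysis"
begin

text \<open>
  The system is \<open>x(t+1) = f (x(t)) (u(t)) \<xi>\<close> with state in \<open>real^'n\<close>, input in \<open>real^'m\<close> and
  parameter in \<open>real^'p\<close>. An input sequence is a total function on \<open>nat\<close>; a finite sequence
  \<open>u[t0,t1]\<close> is represented by any function with these values, and nothing below depends on
  the values outside the relevant time window.
\<close>

definition class_C1 :: "('a::real_normed_vector \<Rightarrow> 'b::real_normed_vector) \<Rightarrow> bool" where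
  "class_C1 F \<longleftrightarrow>
     (\<exists>F' :: 'a \<Rightarrow> 'a \<Rightarrow>\<^sub>L 'b.
        (\<forall>z. (F has_derivative blinfun_apply (F' z)) (at z)) \<and> continuous_on UNIV F')"

primrec iterate_sys ::
  "('x \<Rightarrow> 'u \<Rightarrow> 'q \<Rightarrow> 'x) \<Rightarrow> nat \<Rightarrow> 'x \<Rightarrow> (nat \<Rightarrow> 'u) \<Rightarrow> 'q \<Rightarrow> nat \<Rightarrow> 'x" where
  "iterate_sys f t0 x u \<xi> 0 = x"
| "iterate_sys f t0 x u \<xi> (Suc s) = f (iterate_sys f t0 x u \<xi> s) (u (t0 + s)) \<xi>"

text \<open>\<open>phi f t1 t0 x u \<xi>\<close> is \<open>\<phi>(t1, t0, x; u, \<xi>)\<close>; it is meant for \<open>t0 \<le> t1\<close>.\<close>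

definition phi ::
  "('x \<Rightarrow> 'u \<Rightarrow> 'q \<Rightarrow> 'x) \<Rightarrow> nat \<Rightarrow> nat \<Rightarrow> 'x \<Rightarrow> (nat \<Rightarrow> 'u) \<Rightarrow> 'q \<Rightarrow> 'x" where
  "phi f t1 t0 x u \<xi> = iterate_sys f t0 x u \<xi> (t1 - t0)"

definition alg_reachable ::
  "('x \<Rightarrow> 'u \<Rightarrow> 'q \<Rightarrow> 'x) \<Rightarrow> 'q set \<Rightarrow> 'x \<Rightarrow> bool" where
  "alg_reachable f \<Omega> xs \<longleftrightarrow> (\<forall>x. \<forall>\<xi>\<in>\<Omega>. \<exists>N>0. \<exists>u. phi f N 0 x u \<xi> = xs)"

text \<open>
  Rank at \<open>\<xi>\<close> of the Jacobian of the stacked map \<open>(F 0, \<dots>, F N)\<close>. This matrix has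
  \<open>CARD('n) * (N + 1)\<close> rows, a number that is not the cardinality of a fixed index type, so
  the library function \<open>rank\<close>, which is the dimension of (the span of) the set of rows
  (\<open>row_rank_def\<close>), is written out: the rows of the stacked Jacobian are the rows of the
  Jacobians of the blocks.
\<close>

definition stacked_jacobian_rank :: "nat \<Rightarrow> (nat \<Rightarrow> real^'p \<Rightarrow> real^'n) \<Rightarrow> real^'p \<Rightarrow> nat" where
  "stacked_jacobian_rank N F \<xi> = dim (\<Union>t\<in>{0..N}. rows (jacobian (F t) (at \<xi>)))"

definition excitation ::
  "(real^'n \<Rightarrow> real^'m \<Rightarrow> real^'p \<Rightarrow> real^'n) \<Rightarrow> (real^'p) set \<Rightarrow> nat \<Rightarrow> (nat \<Rightarrow> real^'m) \<Rightarrow> bool" where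
  "excitation f \<Omega> N u \<longleftrightarrow>
     (\<forall>x. \<forall>\<xi>\<in>\<Omega>. stacked_jacobian_rank N (\<lambda>t \<zeta>. phi f t 0 x u \<zeta>) \<xi> = CARD('p))"

text \<open>
  A configuration at the head of the loop: the counter \<open>k\<close>, the time \<open>T\<^sub>k\<close>, the inputs
  applied so far (the values at times \<open>< T\<^sub>k\<close>), and the actual state \<open>x(T\<^sub>k)\<close> of the system.
\<close>

datatype ('x, 'u) config =
  Config (counter: nat) (time: nat) (inputs: "nat \<Rightarrow> 'u") (state: 'x)

definition g_vec ::
  "('x \<Rightarrow> 'u \<Rightarrow> 'q \<Rightarrow> 'x) \<Rightarrow> 'x \<Rightarrow> nat \<Rightarrow> (nat \<Rightarrow> 'u) \<Rightarrow> 'q \<Rightarrow> 'x list" where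
  "g_vec f x0 T u \<xi> = map (\<lambda>t. phi f t 0 x0 u \<xi>) [1..<Suc T]"

definition h_vec ::
  "('x \<Rightarrow> 'u \<Rightarrow> 'q \<Rightarrow> 'x) \<Rightarrow> 'x \<Rightarrow> nat \<Rightarrow> nat \<Rightarrow> (nat \<Rightarrow> 'u) \<Rightarrow> 'q \<Rightarrow> 'x" where
  "h_vec f x0 T N u \<xi> = phi f (T + N) 0 x0 u \<xi>"

definition initial_config ::
  "(real^'n \<Rightarrow> real^'m \<Rightarrow> real^'p \<Rightarrow> real^'n) \<Rightarrow> (real^'p) set \<Rightarrow> real^'p \<Rightarrow> real^'n
     \<Rightarrow> (real^'n, real^'m) config \<Rightarrow> bool" where
  "initial_config f \<Omega> \<theta> x0 c \<longleftrightarrow>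
     (\<exists>N0 u. excitation f \<Omega> N0 u \<and> c = Config 1 N0 u (phi f N0 0 x0 u \<theta>))"

definition valid_estimate ::
  "('x \<Rightarrow> 'u \<Rightarrow> 'q \<Rightarrow> 'x) \<Rightarrow> 'q set \<Rightarrow> 'q \<Rightarrow> 'x \<Rightarrow> ('x, 'u) config \<Rightarrow> 'q \<Rightarrow> bool" where
  "valid_estimate f \<Omega> \<theta> x0 c \<theta>k \<longleftrightarrow>
     \<theta>k \<in> \<Omega> \<and> g_vec f x0 (time c) (inputs c) \<theta>k = g_vec f x0 (time c) (inputs c) \<theta>"

text \<open>\<open>v\<close> extends the inputs already applied by \<open>N\<close> new ones.\<close>

definition valid_control ::
  "('x \<Rightarrow> 'u \<Rightarrow> 'q \<Rightarrow> 'x) \<Rightarrow> 'x \<Rightarrow> 'x \<Rightarrow> ('x, 'u) config \<Rightarrow> 'q \<Rightarrow> nat \<Rightarrow> (nat \<Rightarrow> 'u) \<Rightarrow> bool" where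
  "valid_control f xs x0 c \<theta>k N v \<longleftrightarrow>
     N > 0 \<and> (\<forall>t < time c. v t = inputs c t) \<and> h_vec f x0 (time c) N v \<theta>k = xs"

definition loop_step ::
  "('x \<Rightarrow> 'u \<Rightarrow> 'q \<Rightarrow> 'x) \<Rightarrow> 'q set \<Rightarrow> 'q \<Rightarrow> 'x \<Rightarrow> 'x
     \<Rightarrow> ('x, 'u) config \<Rightarrow> ('x, 'u) config \<Rightarrow> bool" where
  "loop_step f \<Omega> \<theta> xs x0 c c' \<longleftrightarrow>
     state c \<noteq> xs \<and>
     (\<exists>\<theta>k N v. valid_estimate f \<Omega> \<theta> x0 c \<theta>k \<and> valid_control f xs x0 c \<theta>k N v \<and>
        c' = Config (Suc (counter c)) (time c + N) v
               (phi f (time c + N) (time c) (state c) v \<theta>))"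

end

(*
  An estimate that reproduces the data up to T_k but fails to steer the true system to the
  target is falsified by the data up to T_(k+1), so the estimates of a run that does not stop are
  pairwise different. All of them lie in the set of those parameters in Omega that reproduce the
  data of the excitation phase. By the rank condition each point of this set is isolated, and the
  set is compact, hence finite.
*)
theory Submission
  imports Defs
begin

section \<open>Isolated solutions\<close>

text \<open>In finite dimension an injective linear map satisfies
  \<open>B * norm h \<le> norm (f' h)\<close> for some B > 0. Near x the remainder of the linear
  approximation is at most half of this bound, too small to cancel the linear term.\<close>

lemma injective_derivative_eventually_neq:
  fixes f :: "'a::euclidean_space \<Rightarrow> 'b::euclidean_space"
  assumes "(f has_derivative f') (at x)" "inj f'"
  shows "\<forall>\<^sub>F y in at x. f y \<noteq> f x"
proof -
  have lin: "linear f'"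
    using assms(1) has_derivative_linear by blast
  obtain B where B: "B > 0" "\<And>h. B * norm h \<le> norm (f' h)"
    using linear_inj_bounded_below_pos[OF lin assms(2)] by (metis mult.commute)
  obtain d where d: "d > 0"
    "\<And>y. norm (y - x) < d \<Longrightarrow> norm (f y - f x - f' (y - x)) \<le> B / 2 * norm (y - x)"
    using assms(1) B(1) unfolding has_derivative_at_alt by (meson half_gt_zero)
  have "f y \<noteq> f x" if y: "y \<noteq> x" "dist y x < d" for y
  proof
    assume "f y = f x"
    then have "norm (f' (y - x)) \<le> B / 2 * norm (y - x)"
      using d(2)[of y] y by (simp add: dist_norm)
    with B(2)[of "y - x"] have "B * norm (y - x) \<le> B / 2 * norm (y - x)"
      by linarith
    then show False
      using B(1) y(1) by simp
  qed
  then show ?thesis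
    unfolding eventually_at using d(1) by blast
qed

text \<open>Full rank makes the rows of all blocks together span the space. A vector annihilated by
  every block is orthogonal to each row, hence to the whole span, itself included.\<close>

lemma stacked_jacobian_rank_kernel:
  fixes F :: "nat \<Rightarrow> real^'p \<Rightarrow> real^'n"
  assumes rank: "stacked_jacobian_rank N F \<xi> = CARD('p)"
    and diff: "\<And>t. F t differentiable at \<xi>"
    and h: "\<And>t. t \<le> N \<Longrightarrow> frechet_derivative (F t) (at \<xi>) h = 0"
  shows "h = 0"
proof -
  let ?R = "\<Union>t\<in>{0..N}. rows (jacobian (F t) (at \<xi>))"
  have "span ?R = UNIV"
    using rank dim_eq_full[of ?R] by (simp add: stacked_jacobian_rank_def)
  moreover have "orthogonal h r" if "r \<in> ?R" for r
  proof -
    from that obtain t i where t: "t \<le> N" and r: "r = row i (jacobian (F t) (at \<xi>))"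
      by (auto simp: rows_def)
    have "(F t has_derivative (*v) (jacobian (F t) (at \<xi>))) (at \<xi>)"
      using diff jacobian_works by blast
    then have "jacobian (F t) (at \<xi>) *v h = 0"
      using h[OF t] frechet_derivative_at by metis
    then have "(jacobian (F t) (at \<xi>) *v h) $ i = 0"
      by simp
    then show ?thesis
      unfolding r by (simp add: matrix_vector_mul_component orthogonal_def row_def inner_commute)
  qed
  ultimately have "orthogonal h h"
    using orthogonal_to_span[of h ?R h] by blast
  then show ?thesis
    by (simp add: orthogonal_self)
qed

lemma stacked_jacobian_rank_eventually_neq:
  fixes F :: "nat \<Rightarrow> real^'p \<Rightarrow> real^'n"
  assumes rank: "stacked_jacobian_rank N F \<xi> = CARD('p)"
    and diff: "\<And>t. F t differentiable at \<xi>"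
  shows "\<forall>\<^sub>F y in at \<xi>. \<exists>t\<le>N. F t y \<noteq> F t \<xi>"
proof -
  define D where "D t = frechet_derivative (F t) (at \<xi>)" for t
  have D: "(F t has_derivative D t) (at \<xi>)" for t
    using diff frechet_derivative_works unfolding D_def by blast
  have lin: "linear (D t)" for t
    using D has_derivative_linear by blast
  \<comment> \<open>Composing the stacked map with the transpose of its Jacobian gives a map between fixed
    Euclidean spaces whose derivative, a Gram matrix, is injective.\<close>
  define G where "G y = (\<Sum>t\<le>N. adjoint (D t) (F t y))" for y
  define G' where "G' h = (\<Sum>t\<le>N. adjoint (D t) (D t h))" for h
  have "((\<lambda>y. adjoint (D t) (F t y)) has_derivative (\<lambda>h. adjoint (D t) (D t h))) (at \<xi>)" for t
    using bounded_linear.has_derivative[OF _ D] lin adjoint_linear linear_conv_bounded_linear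
    by blast
  then have G: "(G has_derivative G') (at \<xi>)"
    unfolding G_def G'_def by (intro has_derivative_sum)
  have "h = 0" if "G' h = 0" for h
  proof -
    \<comment> \<open>Pairing with h moves each adjoint to the other side and leaves a sum of
      squares, so \<open>G' h = 0\<close> forces every \<open>D t h\<close> to vanish.\<close>
    have "(\<Sum>t\<le>N. D t h \<bullet> D t h) = h \<bullet> G' h"
      unfolding G'_def inner_sum_right using adjoint_works[OF lin] by simp
    then have "(\<Sum>t\<le>N. D t h \<bullet> D t h) = 0"
      using that by simp
    then have "\<forall>t\<le>N. D t h = 0"
      by (subst (asm) sum_nonneg_eq_0_iff) auto
    then show ?thesis
      using stacked_jacobian_rank_kernel[OF rank diff] by (simp add: D_def)
  qed
  then have "inj G'"
    using has_derivative_linear[OF G] by (simp add: linear_injective_0)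
  then have "\<forall>\<^sub>F y in at \<xi>. G y \<noteq> G \<xi>"
    by (rule injective_derivative_eventually_neq[OF G])
  then show ?thesis
  proof (rule eventually_mono)
    fix y
    assume "G y \<noteq> G \<xi>"
    moreover have "G y = G \<xi>" if "\<And>t. t \<le> N \<Longrightarrow> F t y = F t \<xi>"
      unfolding G_def using that by (intro sum.cong) auto
    ultimately show "\<exists>t\<le>N. F t y \<noteq> F t \<xi>"
      by blast
  qed
qed

lemma finite_solutions_if_full_rank:
  fixes F :: "nat \<Rightarrow> real^'p \<Rightarrow> real^'n"
  assumes "compact \<Omega>"
    and rank: "\<And>\<xi>. \<xi> \<in> \<Omega> \<Longrightarrow> stacked_jacobian_rank N F \<xi> = CARD('p)"
    and diff: "\<And>t \<xi>. F t differentiable at \<xi>"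
  shows "finite {\<xi>\<in>\<Omega>. \<forall>t\<le>N. F t \<xi> = F t \<theta>}" (is "finite ?S")
proof (rule ccontr)
  assume "infinite ?S"
  then obtain \<xi> where \<xi>: "\<xi> \<in> \<Omega>" "\<xi> islimpt ?S"
    using Heine_Borel_imp_Bolzano_Weierstrass[OF \<open>compact \<Omega>\<close>, of ?S] by auto
  have "continuous_on UNIV (F t)" for t
    by (simp add: continuous_at_imp_continuous_on diff differentiable_imp_continuous_within)
  then have "closed (\<Inter>t\<in>{..N}. {\<xi>. F t \<xi> = F t \<theta>})"
    by (intro closed_INT ballI closed_Collect_eq continuous_on_const)
  moreover have "?S = \<Omega> \<inter> (\<Inter>t\<in>{..N}. {\<xi>. F t \<xi> = F t \<theta>})"
    by auto
  ultimately have "closed ?S"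
    using closed_Int[OF compact_imp_closed[OF \<open>compact \<Omega>\<close>]] by simp
  \<comment> \<open>The rank condition isolates \<xi> among the solutions of
    \<open>F t y = F t \<xi>\<close>. Membership in \<open>?S\<close> turns this into isolation
    among the solutions of \<open>F t y = F t \<theta>\<close>.\<close>
  then have "\<xi> \<in> ?S"
    using \<xi>(2) closed_limpt by blast
  have "\<exists>\<^sub>F y in at \<xi>. y \<in> ?S"
    using \<xi>(2) by (simp add: islimpt_conv_frequently_at)
  moreover have "\<forall>\<^sub>F y in at \<xi>. y \<notin> ?S"
    using stacked_jacobian_rank_eventually_neq[OF rank[OF \<xi>(1)] diff]
    by (rule eventually_mono) (use \<open>\<xi> \<in> ?S\<close> in auto)
  ultimately show False
    by (simp add: frequently_def)
qed

section \<open>Solutions of the system\<close>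

lemma iterate_sys_cong:
  assumes "\<And>i. i < s \<Longrightarrow> u (a + i) = v (b + i)"
  shows "iterate_sys f a x u \<xi> s = iterate_sys f b x v \<xi> s"
  using assms by (induction s) auto

lemma iterate_sys_add:
  "iterate_sys f t0 x u \<xi> (r + s) = iterate_sys f (t0 + r) (iterate_sys f t0 x u \<xi> r) u \<xi> s"
  by (induction s) (auto simp: add.assoc)

lemma phi_cong:
  assumes "\<And>s. s < t \<Longrightarrow> u s = v s"
  shows "phi f t 0 x u \<xi> = phi f t 0 x v \<xi>"
  unfolding phi_def using assms by (intro iterate_sys_cong) simp

lemma phi_trans: "phi f (T + N) T (phi f T 0 x u \<xi>) u \<xi> = phi f (T + N) 0 x u \<xi>"
  using iterate_sys_add[of f 0 x u \<xi> T N] by (simp add: phi_def)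

lemma iterate_sys_differentiable:
  assumes "class_C1 (\<lambda>(x, u, \<xi>). f x u \<xi>)"
  shows "(\<lambda>\<xi>. iterate_sys f t0 x u \<xi> s) differentiable at \<xi>"
proof (induction s)
  case (Suc s)
  \<comment> \<open>The parameter enters a step both directly and through the preceding state, while
    the input is constant in it; \<open>?p\<close> collects these three arguments for the chain
    rule.\<close>
  let ?f = "\<lambda>(x, u, \<xi>). f x u \<xi>" and ?p = "\<lambda>\<xi>. (iterate_sys f t0 x u \<xi> s, u (t0 + s), \<xi>)"
  have "?f differentiable at z" for z
    using assms unfolding class_C1_def differentiable_def by blast
  moreover from Suc.IH obtain D where "((\<lambda>\<xi>. iterate_sys f t0 x u \<xi> s) has_derivative D) (at \<xi>)"
    unfolding differentiable_def by blast
  then have "(?p has_derivative (\<lambda>h. (D h, 0, h))) (at \<xi>)"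
    by (intro has_derivative_Pair has_derivative_const has_derivative_ident)
  then have "?p differentiable at \<xi>"
    unfolding differentiable_def by blast
  ultimately have "(?f \<circ> ?p) differentiable at \<xi>"
    by (intro differentiable_chain_at)
  then show ?case
    by (simp add: o_def)
qed simp

lemma phi_differentiable:
  assumes "class_C1 (\<lambda>(x, u, \<xi>). f x u \<xi>)"
  shows "(\<lambda>\<xi>. phi f t1 t0 x u \<xi>) differentiable at \<xi>"
  using iterate_sys_differentiable[OF assms] by (simp add: phi_def)

section \<open>Runs of the algorithm\<close>

text \<open>The data vector starts at time 1, the stacked map of the rank condition at time 0. The
  added equation is trivial, since the initial state does not depend on the parameter.\<close>

lemma valid_estimate_iff:
  "valid_estimate f \<Omega> \<theta> x0 c \<xi> \<longleftrightarrow>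
     \<xi> \<in> \<Omega> \<and> (\<forall>t\<le>time c. phi f t 0 x0 (inputs c) \<xi> = phi f t 0 x0 (inputs c) \<theta>)"
proof -
  have "phi f 0 0 x0 (inputs c) \<xi> = phi f 0 0 x0 (inputs c) \<theta>"
    by (simp add: phi_def)
  then have "(\<forall>t\<in>{1..<Suc (time c)}. phi f t 0 x0 (inputs c) \<xi> = phi f t 0 x0 (inputs c) \<theta>) \<longleftrightarrow>
      (\<forall>t\<le>time c. phi f t 0 x0 (inputs c) \<xi> = phi f t 0 x0 (inputs c) \<theta>)"
    by (metis Suc_leI atLeastLessThan_iff less_Suc_eq_le not_gr0 One_nat_def)
  then show ?thesis
    unfolding valid_estimate_def g_vec_def map_eq_conv set_upt by blast
qed

lemma valid_control_exists:
  assumes "alg_reachable f \<Omega> xs" "\<xi> \<in> \<Omega>"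
  shows "\<exists>N v. valid_control f xs x0 c \<xi> N v"
proof -
  let ?T = "time c"
  obtain N u where N: "N > 0" and u: "phi f N 0 (phi f ?T 0 x0 (inputs c) \<xi>) u \<xi> = xs"
    using assms unfolding alg_reachable_def by blast
  \<comment> \<open>Reachability is stated from time 0, so it is applied to the state that \<xi>
    predicts at time \<open>?T\<close>; the resulting input is then delayed by \<open>?T\<close> and
    appended to the inputs already applied.\<close>
  define v where "v t = (if t < ?T then inputs c t else u (t - ?T))" for t
  have "phi f (?T + N) 0 x0 v \<xi> = phi f (?T + N) ?T (phi f ?T 0 x0 v \<xi>) v \<xi>"
    by (simp add: phi_trans)
  also have "phi f ?T 0 x0 v \<xi> = phi f ?T 0 x0 (inputs c) \<xi>"
    by (rule phi_cong) (simp add: v_def)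
  also have "phi f (?T + N) ?T (phi f ?T 0 x0 (inputs c) \<xi>) v \<xi> = xs"
    \<comment> \<open>The instantiation unfolds only the outer solution, not the predicted state
      from which it starts; what remains is invariance under the time shift by
      \<open>?T\<close>.\<close>
    unfolding u[symmetric] phi_def[of _ _ _ "phi _ _ _ _ _ _"]
    by simp (rule iterate_sys_cong, simp add: v_def)
  finally show ?thesis
    using N unfolding valid_control_def h_vec_def by (metis v_def)
qed

lemma loop_stepE:
  assumes "loop_step f \<Omega> \<theta> xs x0 c c'"
  obtains \<xi> where "valid_estimate f \<Omega> \<theta> x0 c \<xi>" "state c \<noteq> xs" "time c < time c'"
    "\<And>t. t < time c \<Longrightarrow> inputs c' t = inputs c t"
    "phi f (time c') 0 x0 (inputs c') \<xi> = xs"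
    "state c' = phi f (time c') (time c) (state c) (inputs c') \<theta>"
proof -
  from assms obtain \<xi> N v where "valid_estimate f \<Omega> \<theta> x0 c \<xi>" "valid_control f xs x0 c \<xi> N v"
    "state c \<noteq> xs"
    "c' = Config (Suc (counter c)) (time c + N) v (phi f (time c + N) (time c) (state c) v \<theta>)"
    unfolding loop_step_def by blast
  then show thesis
    by (intro that[of \<xi>]) (auto simp: valid_control_def h_vec_def)
qed

text \<open>A step restarts the true system at the current state. As it leaves earlier inputs
  unchanged, the new segment continues the trajectory from \<open>x0\<close>.\<close>

lemma loop_step_state:
  assumes step: "loop_step f \<Omega> \<theta> xs x0 c c'"
    and "state c = phi f (time c) 0 x0 (inputs c) \<theta>"
  shows "state c' = phi f (time c') 0 x0 (inputs c') \<theta>"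
  using step
proof (cases rule: loop_stepE)
  case (1 \<xi>)
  have "phi f (time c) 0 x0 (inputs c) \<theta> = phi f (time c) 0 x0 (inputs c') \<theta>"
    by (rule phi_cong) (simp add: 1)
  then show ?thesis
    using assms(2) 1(3,6) phi_trans[of f "time c" "time c' - time c" x0 "inputs c'" \<theta>] by simp
qed

lemma reachable_state:
  assumes "initial_config f \<Omega> \<theta> x0 c0" "(loop_step f \<Omega> \<theta> xs x0)\<^sup>*\<^sup>* c0 c"
  shows "state c = phi f (time c) 0 x0 (inputs c) \<theta>"
  using assms(2)
proof (induction rule: rtranclp_induct)
  case base
  then show ?case
    using assms(1) by (auto simp: initial_config_def)
next
  case (step c c')
  then show ?case
    by (simp add: loop_step_state)
qed

lemma no_infinite_run:
  fixes f :: "real^'n \<Rightarrow> real^'m \<Rightarrow> real^'p \<Rightarrow> real^'n"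
  assumes C1: "class_C1 (\<lambda>(x, u, \<xi>). f x u \<xi>)" and "compact \<Omega>"
    and init: "initial_config f \<Omega> \<theta> x0 (c 0)"
    and steps: "\<And>i. loop_step f \<Omega> \<theta> xs x0 (c i) (c (Suc i))"
  shows False
proof -
  \<comment> \<open>This fixes one estimate per iteration, together with its prediction that the
    target is hit at the end of that iteration.\<close>
  have "\<forall>i. \<exists>\<xi>. valid_estimate f \<Omega> \<theta> x0 (c i) \<xi> \<and>
      phi f (time (c (Suc i))) 0 x0 (inputs (c (Suc i))) \<xi> = xs"
    using steps by (metis loop_stepE)
  then obtain \<xi> where est: "\<And>i. valid_estimate f \<Omega> \<theta> x0 (c i) (\<xi> i)"
    and target: "\<And>i. phi f (time (c (Suc i))) 0 x0 (inputs (c (Suc i))) (\<xi> i) = xs"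
    by metis
  have time: "time (c i) \<le> time (c j)" if "i \<le> j" for i j
    using that by (rule lift_Suc_mono_le[rotated]) (meson steps loop_stepE less_imp_le)
  have inputs: "inputs (c j) t = inputs (c i) t" if "i \<le> j" "t < time (c i)" for i j t
    using that(1)
  proof (induction j rule: dec_induct)
    case (step j)
    then have "t < time (c j)"
      using time[of i j] that(2) by simp
    then show ?case
      using step steps[of j] by (metis loop_stepE)
  qed simp
  \<comment> \<open>Later iterations only append inputs, so a later estimate also reproduces all
    data recorded earlier.\<close>
  have fits: "phi f t 0 x0 (inputs (c i)) (\<xi> j) = phi f t 0 x0 (inputs (c i)) \<theta>"
    if "i \<le> j" "t \<le> time (c i)" for i j t
  proof -
    have "phi f t 0 x0 (inputs (c i)) \<zeta> = phi f t 0 x0 (inputs (c j)) \<zeta>" for \<zeta>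
      using inputs[OF that(1)] that(2) by (intro phi_cong) simp
    then show ?thesis
      using est[of j] time[OF that(1)] that(2) by (simp add: valid_estimate_iff)
  qed
  have state: "state (c i) = phi f (time (c i)) 0 x0 (inputs (c i)) \<theta>" for i
  proof (induction i)
    case 0
    then show ?case
      using reachable_state[OF init] by blast
  next
    case (Suc i)
    then show ?case
      using loop_step_state[OF steps] by blast
  qed
  have "\<xi> i \<noteq> \<xi> j" if "i < j" for i j
  proof
    assume "\<xi> i = \<xi> j"
    \<comment> \<open>As a later estimate, \<open>\<xi> j\<close> fits the data up to the end of
      iteration i; as \<open>\<xi> i\<close>, it predicts \<open>xs\<close> at that time. The actual
      state would then be \<open>xs\<close>, where the loop stops.\<close>
    then have "state (c (Suc i)) = xs"
      using fits[of "Suc i" j "time (c (Suc i))"] target[of i] state[of "Suc i"] that by simp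
    then show False
      using steps[of "Suc i"] by (simp add: loop_step_def)
  qed
  then have "inj \<xi>"
    by (metis injI linorder_neqE_nat)
  then have "infinite (range \<xi>)"
    by (simp add: finite_image_iff)
  \<comment> \<open>At \<open>c 0\<close> exactly the excitation signal has been applied, so the
    rank condition covers this time window.\<close>
  moreover have "finite {\<zeta>\<in>\<Omega>. \<forall>t\<le>time (c 0).
      phi f t 0 x0 (inputs (c 0)) \<zeta> = phi f t 0 x0 (inputs (c 0)) \<theta>}" (is "finite ?S")
  proof (rule finite_solutions_if_full_rank[OF \<open>compact \<Omega>\<close> _ phi_differentiable[OF C1]])
    have "excitation f \<Omega> (time (c 0)) (inputs (c 0))"
      using init by (auto simp: initial_config_def)
    then show "stacked_jacobian_rank (time (c 0)) (\<lambda>t. phi f t 0 x0 (inputs (c 0))) \<zeta> = CARD('p)"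
      if "\<zeta> \<in> \<Omega>" for \<zeta>
      using that by (simp add: excitation_def)
  qed
  moreover have "range \<xi> \<subseteq> ?S"
    using est fits[of 0] by (auto simp: valid_estimate_iff)
  ultimately show False
    using finite_subset by blast
qed

theorem theorem1:
  fixes f :: "real^'n \<Rightarrow> real^'m \<Rightarrow> real^'p \<Rightarrow> real^'n"
    and \<Omega> :: "(real^'p) set"
    and \<theta> :: "real^'p"
    and xs x0 :: "real^'n"
  assumes "class_C1 (\<lambda>(x, u, \<xi>). f x u \<xi>)"
    and "compact \<Omega>" and "convex \<Omega>" and "\<theta> \<in> \<Omega>"
    and "alg_reachable f \<Omega> xs"
    and "\<exists>N u. excitation f \<Omega> N u"
  shows "(\<exists>c. initial_config f \<Omega> \<theta> x0 c) \<and>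
    \<comment> \<open>the equations to be solved in an iteration always have solutions\<close>
    (\<forall>c0 c. initial_config f \<Omega> \<theta> x0 c0 \<and> (loop_step f \<Omega> \<theta> xs x0)\<^sup>*\<^sup>* c0 c \<and> state c \<noteq> xs \<longrightarrow>
       (\<exists>\<theta>k. valid_estimate f \<Omega> \<theta> x0 c \<theta>k) \<and>
       (\<forall>\<theta>k. valid_estimate f \<Omega> \<theta> x0 c \<theta>k \<longrightarrow> (\<exists>N v. valid_control f xs x0 c \<theta>k N v))) \<and>
    \<comment> \<open>no run is infinite\<close>
    \<not> (\<exists>c. initial_config f \<Omega> \<theta> x0 (c 0) \<and> (\<forall>i. loop_step f \<Omega> \<theta> xs x0 (c i) (c (Suc i)))) \<and>
    \<comment> \<open>a run that cannot be continued has brought the system to the target\<close>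
    (\<forall>c0 c. initial_config f \<Omega> \<theta> x0 c0 \<and> (loop_step f \<Omega> \<theta> xs x0)\<^sup>*\<^sup>* c0 c \<and>
       (\<nexists>c'. loop_step f \<Omega> \<theta> xs x0 c c') \<longrightarrow>
       state c = xs \<and> phi f (time c) 0 x0 (inputs c) \<theta> = xs)"
proof (intro conjI allI impI notI; (elim conjE exE)?)
  show "\<exists>c. initial_config f \<Omega> \<theta> x0 c"
    using assms(6) unfolding initial_config_def by blast
next
  fix c
  show "\<exists>\<xi>. valid_estimate f \<Omega> \<theta> x0 c \<xi>"
    \<comment> \<open>The true parameter always reproduces its own data.\<close>
    using \<open>\<theta> \<in> \<Omega>\<close> by (auto simp: valid_estimate_iff)
next
  fix c \<xi>
  assume "valid_estimate f \<Omega> \<theta> x0 c \<xi>"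
  then show "\<exists>N v. valid_control f xs x0 c \<xi> N v"
    using valid_control_exists[OF assms(5)] by (simp add: valid_estimate_iff)
next
  fix c
  assume "initial_config f \<Omega> \<theta> x0 (c 0)" "\<forall>i. loop_step f \<Omega> \<theta> xs x0 (c i) (c (Suc i))"
  then show False
    using no_infinite_run[OF assms(1,2)] by blast
next
  fix c0 c
  assume run: "initial_config f \<Omega> \<theta> x0 c0" "(loop_step f \<Omega> \<theta> xs x0)\<^sup>*\<^sup>* c0 c"
    and stop: "\<nexists>c'. loop_step f \<Omega> \<theta> xs x0 c c'"
  \<comment> \<open>The true parameter and a control computed for it would give a further step, so
    only the guard \<open>state c \<noteq> xs\<close> can fail.\<close>
  have "valid_estimate f \<Omega> \<theta> x0 c \<theta>"
    using \<open>\<theta> \<in> \<Omega>\<close> by (simp add: valid_estimate_iff)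
  moreover obtain N v where "valid_control f xs x0 c \<theta> N v"
    using valid_control_exists[OF assms(5) \<open>\<theta> \<in> \<Omega>\<close>] by blast
  ultimately show "state c = xs"
    using stop unfolding loop_step_def by blast
  then show "phi f (time c) 0 x0 (inputs c) \<theta> = xs"
    using reachable_state[OF run] by simp
qed

end
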